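(* A simplicial complex $\Delta$ is skeleton-E-chordal if and only if every nonempty induced subcomplex of $\Delta$ has a skeleton-E-simplicial vertex.
   Context: Simplicial complexes are finite and not necessarily pure. A vertex labeling of a complex with $n$ vertices is a bijection of its vertices with $[n]=\{1,\dots,n\}$; $\max f$ is the largest label in a face $f$; the size of a face is its number of vertices. $\Delta$ is skeleton-E-chordal if it has a vertex labeling such that for every two faces $f\neq g$ of $\Delta$ with the same size and the same maximum, every subset $h\subseteq f\cup g$ with $|h|=|f|$ is a face of $\Delta$. A vertex $v$ of a complex $\Gamma$ is skeleton-E-simplicial (in $\Gamma$) if for any two faces $f\ne g$ of $\Gamma$ of the same size that contain $v$, every subset of $f\cup g$ of size $|f|$ is a face of $\Gamma$. A nonempty induced subcomplex is the subcomplex of all faces of $\Delta$ contained in $W$, for some nonempty set $W$ of vertices of $\Delta$. *)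

theory Defs
  imports Main
begin

text \<open>A complex is given by its set of faces, the empty face included; its vertices are the
  elements of its faces, so every vertex is a singleton face. The degenerate complexes
  \<open>{}\<close> and \<open>{{}}\<close>, which have no vertices, are both allowed.\<close>

definition simplicial_complex :: "'a set set \<Rightarrow> bool" where
  "simplicial_complex \<Delta> \<longleftrightarrow>
     finite \<Delta> \<and> (\<forall>f\<in>\<Delta>. finite f) \<and> (\<forall>f\<in>\<Delta>. \<forall>h. h \<subseteq> f \<longrightarrow> h \<in> \<Delta>)"

definition vertices :: "'a set set \<Rightarrow> 'a set" where
  "vertices \<Delta> = \<Union>\<Delta>"

definition vertex_labeling :: "'a set set \<Rightarrow> ('a \<Rightarrow> nat) \<Rightarrow> bool" where
  "vertex_labeling \<Delta> l \<longleftrightarrow> bij_betw l (vertices \<Delta>) {1..card (vertices \<Delta>)}"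

text \<open>Distinct finite faces of equal size are nonempty, so the unspecified value of
  \<open>Max {}\<close> plays no role here.\<close>

definition skeleton_E_chordal :: "'a set set \<Rightarrow> bool" where
  "skeleton_E_chordal \<Delta> \<longleftrightarrow>
     (\<exists>l. vertex_labeling \<Delta> l \<and>
        (\<forall>f\<in>\<Delta>. \<forall>g\<in>\<Delta>. f \<noteq> g \<and> card f = card g \<and> Max (l ` f) = Max (l ` g) \<longrightarrow>
           (\<forall>h. h \<subseteq> f \<union> g \<and> card h = card f \<longrightarrow> h \<in> \<Delta>)))"

definition skeleton_E_simplicial :: "'a set set \<Rightarrow> 'a \<Rightarrow> bool" where
  "skeleton_E_simplicial \<Gamma> v \<longleftrightarrow>
     v \<in> vertices \<Gamma> \<and>
     (\<forall>f\<in>\<Gamma>. \<forall>g\<in>\<Gamma>. f \<noteq> g \<and> card f = card g \<and> v \<in> f \<and> v \<in> g \<longrightarrow>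
        (\<forall>h. h \<subseteq> f \<union> g \<and> card h = card f \<longrightarrow> h \<in> \<Gamma>))"

definition induced_subcomplex :: "'a set set \<Rightarrow> 'a set \<Rightarrow> 'a set set" where
  "induced_subcomplex \<Delta> W = {f \<in> \<Delta>. f \<subseteq> W}"

end

theory Submission
  imports Defs
begin

text \<open>The vertex of largest label in an induced subcomplex is skeleton-E-simplicial there, because
  it is the maximum of every face containing it. Conversely, removing skeleton-E-simplicial
  vertices one at a time, and labeling them downwards from the number of vertices, gives a labeling
  in which each vertex is skeleton-E-simplicial in the subcomplex induced on the labels up to its
  own; two faces with the same maximum lie in such a subcomplex and share that vertex.\<close>

text \<open>Induction on proper subsets: a vertex \<open>v\<close> chosen for the whole of
  \<open>W\<close> takes the top label, and the rest is labeled recursively. Asking for a choice in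
  every nonempty subset makes the hypothesis pass to \<open>W - {v}\<close>. The predicate
  \<open>P\<close> stays abstract since only this elimination pattern matters.\<close>

lemma elimination_labeling:
  assumes "finite W" and "\<And>U. U \<noteq> {} \<Longrightarrow> U \<subseteq> W \<Longrightarrow> \<exists>v\<in>U. P U v"
  shows "\<exists>l. bij_betw l W {1..card W} \<and> (\<forall>v\<in>W. P {u\<in>W. l u \<le> l v} v)"
  using assms
proof (induction W rule: finite_psubset_induct)
  case (psubset W)
  show ?case
  proof (cases "W = {}")
    case True
    then show ?thesis by (simp add: bij_betw_def)
  next
    case False
    with psubset.prems obtain v where v: "v \<in> W" "P W v" by blast
    define X where "X = W - {v}"
    have W: "W = insert v X" "v \<notin> X" "finite X"
      using v psubset.hyps by (auto simp: X_def)
    then have card: "card W = Suc (card X)" by simp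
    have "X \<subset> W" using W by blast
    moreover have "\<exists>u\<in>U. P U u" if "U \<noteq> {}" "U \<subseteq> X" for U
      using psubset.prems that W by blast
    ultimately obtain l where l: "bij_betw l X {1..card X}"
      and lP: "\<forall>u\<in>X. P {w\<in>X. l w \<le> l u} u"
      using psubset.IH[of X] by blast
    have le: "l u \<le> card X" if "u \<in> X" for u
      using l that by (auto simp: bij_betw_def)
    \<comment> \<open>The new label is one above all labels on \<open>X\<close>, so no sublevel set
      of another vertex changes.\<close>
    define m where "m = l(v := card W)"
    have m: "m v = Suc (card X)" "\<And>u. u \<in> X \<Longrightarrow> m u = l u"
      using W card by (auto simp: m_def)
    have "bij_betw m X {1..card X}"
      using l bij_betw_cong[of X m l] m by blast
    then have "bij_betw m (insert v X) (insert (m v) {1..card X})"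
      using W m by (simp add: notIn_Un_bij_betw3[of v X m "{1..card X}", simplified])
    moreover have "insert (m v) {1..card X} = {1..card W}"
      using m card by auto
    ultimately have "bij_betw m W {1..card W}" using W by simp
    moreover have "P {w\<in>W. m w \<le> m u} u" if "u \<in> W" for u
    proof (cases "u = v")
      case True
      \<comment> \<open>Every label is at most that of \<open>v\<close>, so the claim for
        \<open>v\<close> is the initial choice \<open>P W v\<close>.\<close>
      have "{w\<in>W. m w \<le> m v} = W"
        using W m le by (fastforce intro: le_SucI)
      then show ?thesis using True v by simp
    next
      case False
      then have u: "u \<in> X" using that W by simp
      then have "{w\<in>W. m w \<le> m u} = {w\<in>X. l w \<le> l u}"
        using W m le[OF u] by auto
      then show ?thesis using lP u by simp
    qed
    ultimately show ?thesis by blast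
  qed
qed

lemma Max_image_witness:
  assumes "finite f" "f \<noteq> {}"
  shows "\<exists>v\<in>f. l v = Max (l ` f) \<and> (\<forall>u\<in>f. l u \<le> l v)"
proof -
  have "Max (l ` f) \<in> l ` f" using assms by simp
  then obtain v where v: "v \<in> f" "l v = Max (l ` f)" by auto
  then have "\<forall>u\<in>f. l u \<le> l v" using assms by simp
  with v show ?thesis by blast
qed

text \<open>Restriction loses no vertex of \<open>W\<close>, because downward closure makes each
  vertex a singleton face.\<close>

lemma vertices_induced_subcomplex:
  assumes "simplicial_complex \<Delta>" "W \<subseteq> vertices \<Delta>"
  shows "vertices (induced_subcomplex \<Delta> W) = W"
proof
  show "W \<subseteq> vertices (induced_subcomplex \<Delta> W)"
  proof
    fix v assume "v \<in> W"
    with assms obtain f where "f \<in> \<Delta>" "v \<in> f" by (auto simp: vertices_def)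
    with assms(1) have "{v} \<in> \<Delta>" by (simp add: simplicial_complex_def)
    with \<open>v \<in> W\<close> show "v \<in> vertices (induced_subcomplex \<Delta> W)"
      by (auto simp: vertices_def induced_subcomplex_def)
  qed
qed (auto simp: vertices_def induced_subcomplex_def)

lemma skeleton_E_simplicialI:
  assumes "v \<in> vertices \<Gamma>"
    and "\<And>f g h. \<lbrakk>f \<in> \<Gamma>; g \<in> \<Gamma>; f \<noteq> g; card f = card g; v \<in> f; v \<in> g; h \<subseteq> f \<union> g;
      card h = card f\<rbrakk> \<Longrightarrow> h \<in> \<Gamma>"
  shows "skeleton_E_simplicial \<Gamma> v"
  unfolding skeleton_E_simplicial_def
proof (intro conjI ballI allI impI)
  fix f g h
  assume "f \<in> \<Gamma>" "g \<in> \<Gamma>" "f \<noteq> g \<and> card f = card g \<and> v \<in> f \<and> v \<in> g"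
    "h \<subseteq> f \<union> g \<and> card h = card f"
  then show "h \<in> \<Gamma>" by (intro assms(2)[of f g h]) simp_all
qed (rule assms(1))

lemma skeleton_E_simplicialD:
  assumes "skeleton_E_simplicial \<Gamma> v" "f \<in> \<Gamma>" "g \<in> \<Gamma>" "f \<noteq> g" "card f = card g"
    "v \<in> f" "v \<in> g" "h \<subseteq> f \<union> g" "card h = card f"
  shows "h \<in> \<Gamma>"
  using assms(1)[unfolded skeleton_E_simplicial_def, THEN conjunct2, rule_format, of f g h] assms(2-)
  by simp

lemma skeleton_E_chordalI:
  assumes "vertex_labeling \<Delta> l"
    and "\<And>f g h. \<lbrakk>f \<in> \<Delta>; g \<in> \<Delta>; f \<noteq> g; card f = card g; Max (l ` f) = Max (l ` g); h \<subseteq> f \<union> g;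
      card h = card f\<rbrakk> \<Longrightarrow> h \<in> \<Delta>"
  shows "skeleton_E_chordal \<Delta>"
  unfolding skeleton_E_chordal_def
proof (intro exI[of _ l] conjI ballI allI impI)
  fix f g h
  assume "f \<in> \<Delta>" "g \<in> \<Delta>" "f \<noteq> g \<and> card f = card g \<and> Max (l ` f) = Max (l ` g)"
    "h \<subseteq> f \<union> g \<and> card h = card f"
  then show "h \<in> \<Delta>" by (intro assms(2)[of f g h]) simp_all
qed (rule assms(1))

theorem theorem3:
  fixes \<Delta> :: "'a set set"
  assumes "simplicial_complex \<Delta>"
  shows "skeleton_E_chordal \<Delta> \<longleftrightarrow>
    (\<forall>W. W \<noteq> {} \<and> W \<subseteq> vertices \<Delta> \<longrightarrow>
       (\<exists>v. skeleton_E_simplicial (induced_subcomplex \<Delta> W) v))"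
    (is "_ \<longleftrightarrow> ?R")
proof
  have fin: "finite (vertices \<Delta>)" and finf: "\<And>f. f \<in> \<Delta> \<Longrightarrow> finite f"
    using assms by (auto simp: simplicial_complex_def vertices_def)
  note vert = vertices_induced_subcomplex[OF assms]
  {
    assume "skeleton_E_chordal \<Delta>"
    then obtain l :: "'a \<Rightarrow> nat" where l: "\<forall>f\<in>\<Delta>. \<forall>g\<in>\<Delta>.
        f \<noteq> g \<and> card f = card g \<and> Max (l ` f) = Max (l ` g) \<longrightarrow>
        (\<forall>h. h \<subseteq> f \<union> g \<and> card h = card f \<longrightarrow> h \<in> \<Delta>)"
      unfolding skeleton_E_chordal_def by (elim exE conjE)
    show ?R
    proof (intro allI impI)
      fix W assume W: "W \<noteq> {} \<and> W \<subseteq> vertices \<Delta>"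
      then have "finite W" using fin finite_subset by blast
      then obtain v where v: "v \<in> W" "\<forall>u\<in>W. l u \<le> l v"
        using W Max_image_witness[of W l] by blast
      \<comment> \<open>Thus any two faces inside \<open>W\<close> through \<open>v\<close> share
        their maximum, which brings the chordality condition to bear on them.\<close>
      have Max: "Max (l ` f) = l v" if "f \<in> \<Delta>" "f \<subseteq> W" "v \<in> f" for f
        using that v finf[of f] by (intro Max_eqI) auto
      have "skeleton_E_simplicial (induced_subcomplex \<Delta> W) v"
      proof (rule skeleton_E_simplicialI)
        show "v \<in> vertices (induced_subcomplex \<Delta> W)" using v(1) vert[of W] W by simp
      next
        fix f g h
        assume f: "f \<in> induced_subcomplex \<Delta> W" "v \<in> f"
          and g: "g \<in> induced_subcomplex \<Delta> W" "v \<in> g"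
          and fg: "f \<noteq> g" "card f = card g"
          and h: "h \<subseteq> f \<union> g" "card h = card f"
        have "f \<in> \<Delta>" "f \<subseteq> W" "g \<in> \<Delta>" "g \<subseteq> W"
          using f g by (simp_all add: induced_subcomplex_def)
        moreover from this have "Max (l ` f) = Max (l ` g)"
          using Max[of f] Max[of g] f g by simp
        ultimately have "h \<in> \<Delta>" using l[rule_format, of f g h] fg h by simp
        \<comment> \<open>Chordality only yields a face of \<open>\<Delta>\<close>; that it stays
          inside \<open>W\<close> comes from \<open>f\<close> and \<open>g\<close>.\<close>
        moreover have "h \<subseteq> W" using h \<open>f \<subseteq> W\<close> \<open>g \<subseteq> W\<close> by blast
        ultimately show "h \<in> induced_subcomplex \<Delta> W" by (simp add: induced_subcomplex_def)
      qed
      then show "\<exists>v. skeleton_E_simplicial (induced_subcomplex \<Delta> W) v" ..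
    qed
  next
    assume R: ?R
    \<comment> \<open>This is the hypothesis of \<open>elimination_labeling\<close>, with
      \<open>P U v\<close> saying that \<open>v\<close> is skeleton-E-simplicial in the subcomplex
      induced on \<open>U\<close>. That \<open>v\<close> lies in \<open>U\<close> follows from its
      being a vertex of that subcomplex.\<close>
    have "\<exists>v\<in>U. skeleton_E_simplicial (induced_subcomplex \<Delta> U) v"
      if "U \<noteq> {}" "U \<subseteq> vertices \<Delta>" for U
    proof -
      obtain v where v: "skeleton_E_simplicial (induced_subcomplex \<Delta> U) v"
        using R \<open>U \<noteq> {}\<close> \<open>U \<subseteq> vertices \<Delta>\<close> by blast
      then have "v \<in> U"
        using vert[OF \<open>U \<subseteq> vertices \<Delta>\<close>] by (simp add: skeleton_E_simplicial_def)
      with v show ?thesis ..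
    qed
    from elimination_labeling[OF fin this] obtain l :: "'a \<Rightarrow> nat"
      where l: "bij_betw l (vertices \<Delta>) {1..card (vertices \<Delta>)}"
        and l_simplicial: "\<And>v. v \<in> vertices \<Delta> \<Longrightarrow>
          skeleton_E_simplicial (induced_subcomplex \<Delta> {u \<in> vertices \<Delta>. l u \<le> l v}) v"
      by blast
    have "h \<in> \<Delta>"
      if fg: "f \<in> \<Delta>" "g \<in> \<Delta>" "f \<noteq> g" "card f = card g" "Max (l ` f) = Max (l ` g)"
        and h: "h \<subseteq> f \<union> g" "card h = card f" for f g h
    proof -
      \<comment> \<open>If one face were empty, the other would be finite of cardinality 0, hence
        equal to it.\<close>
      have "f \<noteq> {}" "g \<noteq> {}" using fg finf[OF fg(1)] finf[OF fg(2)] by auto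
      obtain v where v: "v \<in> f" "l v = Max (l ` f)" "\<forall>u\<in>f. l u \<le> l v"
        using Max_image_witness[OF finf[OF fg(1)] \<open>f \<noteq> {}\<close>, of l] by blast
      obtain w where w: "w \<in> g" "l w = Max (l ` g)" "\<forall>u\<in>g. l u \<le> l w"
        using Max_image_witness[OF finf[OF fg(2)] \<open>g \<noteq> {}\<close>, of l] by blast
      have sub: "f \<subseteq> vertices \<Delta>" "g \<subseteq> vertices \<Delta>" using fg by (auto simp: vertices_def)
      with v w have "v \<in> vertices \<Delta>" "w \<in> vertices \<Delta>" by auto
      \<comment> \<open>Injectivity of the labeling turns equal maxima into a common vertex of
        \<open>f\<close> and \<open>g\<close>.\<close>
      then have "w = v"
        using v(2) w(2) fg(5) inj_onD[OF bij_betw_imp_inj_on[OF l], of w v] by simp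
      let ?W = "{u \<in> vertices \<Delta>. l u \<le> l v}"
      \<comment> \<open>The shared vertex has the largest label in both faces, so both lie in its
        sublevel set.\<close>
      have "f \<in> induced_subcomplex \<Delta> ?W" "g \<in> induced_subcomplex \<Delta> ?W"
        using fg sub v w \<open>w = v\<close> by (auto simp: induced_subcomplex_def)
      then have "h \<in> induced_subcomplex \<Delta> ?W"
        using skeleton_E_simplicialD[OF l_simplicial[OF \<open>v \<in> vertices \<Delta>\<close>]
            _ _ fg(3,4) v(1) _ h] w(1) \<open>w = v\<close>
        by blast
      then show ?thesis by (simp add: induced_subcomplex_def)
    qed
    moreover have "vertex_labeling \<Delta> l" using l by (simp add: vertex_labeling_def)
    ultimately show "skeleton_E_chordal \<Delta>" by (rule skeleton_E_chordalI[rotated])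
  }
qed

end
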